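(* Let $d\ge1$, $0<c_j<1$ for $j=1,\dots,d$, let $\mathbf{X}_0$ and $\mathbf{Y}_n=(Y_{n,1},\dots,Y_{n,d})$, $n\ge1$, be independent random vectors in $\mathbb{R}^d$ with $\mathbf{Y}_n\sim G$ for all $n$, and let $X_{n,j}=\max(c_jX_{n-1,j},\,Y_{n,j})$ for $n\ge1$, $j=1,\dots,d$. Suppose $\{\mathbf{X}_n=(X_{n,1},\dots,X_{n,d})\}$ is stationary with common non-degenerate distribution function $F$ whose margins satisfy $F_j\in\mathcal{D}(H_j)$, $j=1,\dots,d$, where each $H_j$ is a Gumbel, Weibull or Fréchet distribution. Let $\boldsymbol{\tau}=(\tau_1,\dots,\tau_d)$ with $\tau_j\ge0$ and let $\mathbf{u}_n^{(\boldsymbol{\tau})}=(u_{n,1}^{(\tau_1)},\dots,u_{n,d}^{(\tau_d)})$ be normalized levels, i.e. $n\big(1-F_j(u_{n,j}^{(\tau_j)})\big)\to\tau_j$ as $n\to\infty$ for each $j$. Then $\{\mathbf{X}_n\}_{n\ge1}$ satisfies condition $D''(\mathbf{u}_n^{(\boldsymbol{\tau})})$.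
   Context: Inequalities between vectors are componentwise, and $\mathbf{x}\not\le\mathbf{u}$ means that $x_j>u_j$ for at least one $j$. The Gumbel, Weibull and Fréchet distributions are, respectively, $\Lambda(x)=\exp(-e^{-x})$, $\Psi_{\alpha}(x)=e^{-(-x)^{\alpha}}$ for $x\le0$ (and $1$ for $x>0$), and $\Phi_\alpha(x)=e^{-x^{-\alpha}}$ for $x>0$ (and $0$ for $x\le 0$), with $\alpha>0$. $F_j\in\mathcal{D}(H_j)$ means that there are constants $a_{n,j}>0$, $b_{n,j}$ with $n(1-F_j(a_{n,j}x+b_{n,j}))\to-\log H_j(x)$ as $n\to\infty$. A distribution function $F$ on $\mathbb{R}^d$ is non-degenerate if $0<F(\mathbf{x})<1$ for some $\mathbf{x}$. Condition $D(\mathbf{u}_n,\alpha_{l_n})$ (multivariate version of Leadbetter's condition $D$) holds for a stationary sequence if there is a sequence $l_n\to\infty$, $l_n/n\to0$, and numbers $\alpha_{l_n}\to0$ such that, for all $n$ and all integers $1\le i_1<\dots<i_p<j_1<\dots<j_q\le n$ with $j_1-i_p\ge l_n$, $$\Big|P\Big(\bigcap_{r=1}^p\{\mathbf{X}_{i_r}\le\mathbf{u}_n\}\cap\bigcap_{r=1}^q\{\mathbf{X}_{j_r}\le\mathbf{u}_n\}\Big)-P\Big(\bigcap_{r=1}^p\{\mathbf{X}_{i_r}\le\mathbf{u}_n\}\Big)P\Big(\bigcap_{r=1}^q\{\mathbf{X}_{j_r}\le\mathbf{u}_n\}\Big)\Big|\le\alpha_{l_n}.$$ Condition $D''(\mathbf{u}_n)$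 holds if $D(\mathbf{u}_n,\alpha_{l_n})$ holds and $$n\sum_{i=2}^{[n/k_n]}P(\mathbf{X}_1\not\le\mathbf{u}_n,\ \mathbf{X}_i\le\mathbf{u}_n,\ \mathbf{X}_{i+1}\not\le\mathbf{u}_n)\to0$$ for some sequence of positive integers $\{k_n\}$ such that, as $n\to\infty$, $k_n\to\infty$, $k_nl_n/n\to0$ and $k_n\alpha_{l_n}\to0$. *)

theory Defs
  imports "HOL-Probability.Probability"
begin

text \<open>Vectors live in \<^typ>\<open>real^'d\<close>, whose library order is componentwise, so
  \<open>\<not> x \<le> u\<close> means that \<open>x $ j > u $ j\<close> for at least one \<open>j\<close>.\<close>

definition gumbel :: "real \<Rightarrow> real" where
  "gumbel x = exp (- exp (- x))"

definition weibull :: "real \<Rightarrow> real \<Rightarrow> real" where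
  "weibull \<alpha> x = (if x \<le> 0 then exp (- ((- x) powr \<alpha>)) else 1)"

definition frechet :: "real \<Rightarrow> real \<Rightarrow> real" where
  "frechet \<alpha> x = (if x > 0 then exp (- (x powr (- \<alpha>))) else 0)"

definition extreme_value_df :: "(real \<Rightarrow> real) \<Rightarrow> bool" where
  "extreme_value_df H \<longleftrightarrow>
     H = gumbel \<or> (\<exists>\<alpha>>0. H = weibull \<alpha>) \<or> (\<exists>\<alpha>>0. H = frechet \<alpha>)"

text \<open>Minus the logarithm on \<open>[0,1]\<close> with the value \<open>\<infinity>\<close> at \<open>0\<close> (whereas \<open>ln 0 = 0\<close>
  in the library).\<close>

definition neg_log :: "real \<Rightarrow> ereal" where
  "neg_log p = (if p > 0 then ereal (- ln p) else \<infinity>)"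

definition in_domain_of_attraction :: "(real \<Rightarrow> real) \<Rightarrow> (real \<Rightarrow> real) \<Rightarrow> bool" where
  "in_domain_of_attraction F H \<longleftrightarrow>
     (\<exists>a b :: nat \<Rightarrow> real. (\<forall>n. a n > 0) \<and>
       (\<forall>x. (\<lambda>n. ereal (real n * (1 - F (a n * x + b n)))) \<longlonglongrightarrow> neg_log (H x)))"

text \<open>The joint distribution function and the marginal distribution functions of a law
  \<open>\<mu>\<close> on the Borel sets of \<open>\<real>\<^sup>d\<close>.\<close>

definition joint_cdf :: "(real^'d) measure \<Rightarrow> real^'d \<Rightarrow> real" where
  "joint_cdf \<mu> x = measure \<mu> {..x}"

definition margin_cdf :: "(real^'d) measure \<Rightarrow> 'd \<Rightarrow> real \<Rightarrow> real" where
  "margin_cdf \<mu> j = cdf (distr \<mu> borel (\<lambda>x. x $ j))"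

definition nondegenerate_df :: "(real^'d \<Rightarrow> real) \<Rightarrow> bool" where
  "nondegenerate_df F \<longleftrightarrow> (\<exists>x. 0 < F x \<and> F x < 1)"

text \<open>Strict stationarity of \<open>(X\<^sub>n)\<^sub>n\<^sub>\<ge>\<^sub>1\<close>: the finite-dimensional laws are invariant under shifts
  of the time index. The variable \<open>X 0\<close> plays no role.\<close>

definition stationary_seq :: "'a measure \<Rightarrow> (nat \<Rightarrow> 'a \<Rightarrow> real^'d) \<Rightarrow> bool" where
  "stationary_seq M X \<longleftrightarrow>
     (\<forall>I h. finite I \<longrightarrow> I \<subseteq> {1..} \<longrightarrow>
        distr M (PiM I (\<lambda>_. borel)) (\<lambda>\<omega>. \<lambda>i\<in>I. X (i + h) \<omega>) =
        distr M (PiM I (\<lambda>_. borel)) (\<lambda>\<omega>. \<lambda>i\<in>I. X i \<omega>))"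

text \<open>The index strings \<open>i\<^sub>1 < \<dots> < i\<^sub>p\<close> and \<open>j\<^sub>1 < \<dots> < j\<^sub>q\<close> are given by the nonempty finite
  sets \<open>I\<close> and \<open>J\<close> of their entries; \<open>i\<^sub>p = Max I\<close> and \<open>j\<^sub>1 = Min J\<close>.\<close>

definition cond_D ::
  "'a measure \<Rightarrow> (nat \<Rightarrow> 'a \<Rightarrow> real^'d) \<Rightarrow> (nat \<Rightarrow> real^'d) \<Rightarrow> (nat \<Rightarrow> nat) \<Rightarrow> (nat \<Rightarrow> real) \<Rightarrow> bool"
where
  "cond_D M X u l \<alpha> \<longleftrightarrow>
     filterlim l at_top sequentially \<and>
     (\<lambda>n. real (l n) / real n) \<longlonglongrightarrow> 0 \<and>
     (\<lambda>n. \<alpha> (l n)) \<longlonglongrightarrow> 0 \<and>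
     (\<forall>n I J. I \<noteq> {} \<longrightarrow> J \<noteq> {} \<longrightarrow> I \<subseteq> {1..n} \<longrightarrow> J \<subseteq> {1..n} \<longrightarrow>
        Max I < Min J \<longrightarrow> Max I + l n \<le> Min J \<longrightarrow>
        \<bar>measure M {\<omega> \<in> space M. (\<forall>i\<in>I. X i \<omega> \<le> u n) \<and> (\<forall>j\<in>J. X j \<omega> \<le> u n)}
          - measure M {\<omega> \<in> space M. \<forall>i\<in>I. X i \<omega> \<le> u n}
            * measure M {\<omega> \<in> space M. \<forall>j\<in>J. X j \<omega> \<le> u n}\<bar> \<le> \<alpha> (l n))"

definition cond_D'' ::
  "'a measure \<Rightarrow> (nat \<Rightarrow> 'a \<Rightarrow> real^'d) \<Rightarrow> (nat \<Rightarrow> real^'d) \<Rightarrow> bool"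
where
  "cond_D'' M X u \<longleftrightarrow>
     (\<exists>l \<alpha>. cond_D M X u l \<alpha> \<and>
       (\<exists>k :: nat \<Rightarrow> nat. (\<forall>n. k n > 0) \<and>
          filterlim k at_top sequentially \<and>
          (\<lambda>n. real (k n) * real (l n) / real n) \<longlonglongrightarrow> 0 \<and>
          (\<lambda>n. real (k n) * \<alpha> (l n)) \<longlonglongrightarrow> 0 \<and>
          (\<lambda>n. real n * (\<Sum>i = 2..n div k n.
             measure M {\<omega> \<in> space M. \<not> X 1 \<omega> \<le> u n \<and> X i \<omega> \<le> u n \<and> \<not> X (i + 1) \<omega> \<le> u n}))
            \<longlonglongrightarrow> 0))"

end

theory Submission
  imports Defs "HOL-Library.Discrete_Functions" "HOL-Real_Asymp.Real_Asymp"
begin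

text \<open>
  Two features of the max-autoregressive recursion give the theorem.

  A stationary path is nonnegative almost surely. The recursion gives
  \<open>X (n + m) \<ge> c^m * X n\<close> componentwise, so \<open>X (n + m) \<le> t\<close> forces \<open>X n \<le> t / c^m\<close>; since both
  variables have the same law, the marginal distribution function satisfies \<open>F t \<le> F (t / c^m)\<close>,
  and for \<open>t < 0\<close> the right-hand side tends to \<open>0\<close> (lemma \<open>margin_cdf_negative\<close>).

  For nonnegative paths, multiplication by \<open>c < 1\<close> only decreases a component. A component that
  does not exceed its level therefore cannot cause a later exceedance: if \<open>X p \<le> v\<close>, the later
  exceedances of \<open>v\<close> are decided by the innovations after time \<open>p\<close>, which are independent of the
  past. This has two consequences, both in terms of the exceedance probability
  \<open>e = P(\<not> X 1 \<le> v)\<close>.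

  \<^item> Past and future events \<open>\<forall>i\<in>I. X i \<le> v\<close> and \<open>\<forall>j\<in>J. X j \<le> v\<close> are independent up to the error
    \<open>e\<close>, whatever the gap between \<open>I\<close> and \<open>J\<close>: the second event differs from one about
    innovations after \<open>p = Max I\<close> only where \<open>\<not> X p \<le> v\<close> (lemma \<open>mixing_bound\<close>).

  \<^item> An upcrossing \<open>X i \<le> v\<close>, \<open>\<not> X (i + 1) \<le> v\<close> must be caused by the innovation at time \<open>i + 1\<close>,
    which is independent of \<open>X 1\<close>. As innovations lie below the path, an exceedance at time \<open>1\<close>
    together with an upcrossing at time \<open>i\<close> has probability at most \<open>e\<^sup>2\<close>
    (lemma \<open>upcrossing_bound\<close>).

  For normalized levels \<open>e \<le> K / n\<close>. The mixing numbers can then be taken as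
  \<open>\<alpha> m = K / m\<close>, because \<open>l n \<le> n\<close>, and the sum over \<open>i\<close> is at most
  \<open>n * (n / k n) * (K / n)\<^sup>2 = K\<^sup>2 / k n\<close>. Any \<open>l\<close> of order \<open>sqrt n\<close> and \<open>k\<close> of smaller order than
  \<open>l\<close> that tend to infinity satisfy the growth conditions.
\<close>

section \<open>Measurability of vectors and of their order\<close>

lemma borel_measurable_vec_nth [measurable]: "(\<lambda>x :: real^'n. x $ a) \<in> borel_measurable borel"
  by (intro borel_measurable_continuous_onI continuous_intros)

lemma borel_measurable_vec_iff:
  fixes f :: "'a \<Rightarrow> real^'n"
  shows "f \<in> borel_measurable M \<longleftrightarrow> (\<forall>a. (\<lambda>\<omega>. f \<omega> $ a) \<in> borel_measurable M)"
  by (subst borel_measurable_euclidean_space)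
    (auto simp: Basis_vec_def inner_axis)

lemma pred_vec_le [measurable]:
  fixes f :: "'a \<Rightarrow> real^'n"
  assumes [measurable]: "f \<in> borel_measurable M"
  shows "Measurable.pred M (\<lambda>\<omega>. f \<omega> \<le> v)"
  unfolding less_eq_vec_def by measurable

section \<open>Replacing an event by an independent one\<close>

text \<open>The two errors \<open>P(A \<inter> (B' - B))\<close> and \<open>P(A) P(B' - B)\<close>, made by passing from \<open>B\<close> to \<open>B'\<close>
  in the joint probability and in the product, enter with opposite signs; hence the factor \<open>1\<close>
  in the bound.\<close>

lemma (in prob_space) almost_indep_of_superset:
  assumes [measurable]: "A \<in> events" "B \<in> events" "B' \<in> events"
    and "B \<subseteq> B'" and indep: "prob (A \<inter> B') = prob A * prob B'"
  shows "\<bar>prob (A \<inter> B) - prob A * prob B\<bar> \<le> prob (B' - B)"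
proof -
  have B: "prob B = prob B' - prob (B' - B)"
    using \<open>B \<subseteq> B'\<close> by (subst finite_measure_Diff) auto
  have "A \<inter> (B' - B) = (A \<inter> B') - (A \<inter> B)" by auto
  then have AB: "prob (A \<inter> B) = prob A * prob B' - prob (A \<inter> (B' - B))"
    using \<open>B \<subseteq> B'\<close> by (simp only: indep[symmetric]) (subst finite_measure_Diff; auto)
  have "prob (A \<inter> B) - prob A * prob B = prob A * prob (B' - B) - prob (A \<inter> (B' - B))"
    unfolding AB B by (simp add: right_diff_distrib)
  moreover have "prob (A \<inter> (B' - B)) \<le> prob (B' - B)"
    by (intro finite_measure_mono) auto
  moreover have "prob A * prob (B' - B) \<le> 1 * prob (B' - B)"
    by (intro mult_right_mono) auto
  moreover have "0 \<le> prob A * prob (B' - B)" "0 \<le> prob (A \<inter> (B' - B))" by auto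
  ultimately show ?thesis by linarith
qed

section \<open>The recursion as a function of its innovations\<close>

text \<open>The path is a functional of the innovation sequence alone, so that events about
  \<open>X 0, \<dots>, X p\<close> become events in the product space of the first \<open>p + 1\<close> innovations.\<close>

primrec max_ar_path :: "real^'d \<Rightarrow> nat \<Rightarrow> (nat \<Rightarrow> real^'d) \<Rightarrow> real^'d" where
  "max_ar_path c 0 z = z 0"
| "max_ar_path c (Suc n) z = (\<chi> a. max (c $ a * max_ar_path c n z $ a) (z (Suc n) $ a))"

lemma max_ar_path_restrict:
  "n \<le> p \<Longrightarrow> max_ar_path c n (restrict z {..p}) = max_ar_path c n z"
  by (induction n) (auto simp: vec_eq_iff)

lemma measurable_max_ar_path:
  "n \<le> p \<Longrightarrow> max_ar_path c n \<in> borel_measurable (PiM {..p} (\<lambda>_. borel))"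
proof (induction n)
  case 0
  then show ?case by (simp add: measurable_component_singleton)
next
  case (Suc n)
  then have [measurable]: "max_ar_path c n \<in> borel_measurable (PiM {..p} (\<lambda>_. borel))"
    "(\<lambda>z. z (Suc n)) \<in> borel_measurable (PiM {..p} (\<lambda>_. borel))"
    by (auto intro!: measurable_component_singleton)
  show ?case
    by (subst borel_measurable_vec_iff) simp
qed

text \<open>Unfolding the recursion back to time \<open>p\<close> writes the component as a maximum of discounted
  terms. It is stated for upper bounds because a bound on a maximum splits into bounds on its
  terms, and one recursion step merely rescales the bound from \<open>b\<close> to \<open>b / c $ a\<close>.\<close>

lemma max_ar_path_le_iff:
  assumes c: "\<And>a. 0 < c $ a" and "p \<le> j"
  shows "max_ar_path c j z $ a \<le> b \<longleftrightarrow>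
    c $ a ^ (j - p) * max_ar_path c p z $ a \<le> b \<and> (\<forall>k\<in>{p<..j}. c $ a ^ (j - k) * z k $ a \<le> b)"
  using \<open>p \<le> j\<close>
proof (induction j arbitrary: b rule: dec_induct)
  case base
  then show ?case by simp
next
  case (step j)
  have scale: "c $ a * x \<le> b \<longleftrightarrow> x \<le> b / c $ a" for x
    using c[of a] by (simp add: field_simps)
  have pow: "c $ a ^ (Suc j - k) * x \<le> b \<longleftrightarrow> c $ a ^ (j - k) * x \<le> b / c $ a" if "k \<le> j" for k x
    using that by (simp add: Suc_diff_le scale[symmetric] mult.assoc)
  have "{p<..Suc j} = insert (Suc j) {p<..j}"
    using step by auto
  moreover have "(\<forall>k\<in>{p<..j}. c $ a ^ (Suc j - k) * z k $ a \<le> b) \<longleftrightarrow>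
      (\<forall>k\<in>{p<..j}. c $ a ^ (j - k) * z k $ a \<le> b / c $ a)"
    by (intro ball_cong refl pow) simp
  ultimately show ?case
    using step pow[of p] by (auto simp: scale)
qed

section \<open>Max-autoregressive sequences with a common marginal law\<close>

locale stationary_max_ar = prob_space M for M :: "'a measure" +
  fixes X Y :: "nat \<Rightarrow> 'a \<Rightarrow> real^'d" and F :: "(real^'d) measure" and c :: "real^'d"
  assumes c_bounds: "\<And>a. 0 < c $ a \<and> c $ a < 1"
    and indep: "indep_vars (\<lambda>_. borel) (\<lambda>n. if n = 0 then X 0 else Y n) UNIV"
    and recursion: "\<And>n a \<omega>. n \<ge> 1 \<Longrightarrow> \<omega> \<in> space M \<Longrightarrow>
           X n \<omega> $ a = max (c $ a * X (n - 1) \<omega> $ a) (Y n \<omega> $ a)"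
    and law: "\<And>n. n \<ge> 1 \<Longrightarrow> distr M borel (X n) = F"
begin

definition innov :: "nat \<Rightarrow> 'a \<Rightarrow> real^'d" where
  "innov n = (if n = 0 then X 0 else Y n)"

lemma indep_innov: "indep_vars (\<lambda>_. borel) innov UNIV"
  using indep by (simp add: innov_def[abs_def])

lemma measurable_innov [measurable]: "innov n \<in> borel_measurable M"
  using indep_innov by (auto simp: indep_vars_def)

lemma X_eq_path: "\<omega> \<in> space M \<Longrightarrow> X n \<omega> = max_ar_path c n (\<lambda>i. innov i \<omega>)"
proof (induction n)
  case (Suc n)
  then show ?case
    using recursion[of "Suc n" \<omega>] by (auto simp: vec_eq_iff innov_def)
qed (simp add: innov_def)

lemma measurable_X [measurable]: "X n \<in> borel_measurable M"
proof -
  have "(\<lambda>\<omega>. \<lambda>i\<in>{..n}. innov i \<omega>) \<in> measurable M (PiM {..n} (\<lambda>_. borel))"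
    by (intro measurable_restrict) simp
  from measurable_compose[OF this measurable_max_ar_path[OF order_refl, of c n]]
  have "(\<lambda>\<omega>. max_ar_path c n (\<lambda>i. innov i \<omega>)) \<in> borel_measurable M"
    by (simp add: max_ar_path_restrict)
  then show ?thesis
    by (simp add: X_eq_path cong: measurable_cong)
qed

lemma X_Suc: "\<omega> \<in> space M \<Longrightarrow> X (Suc n) \<omega> $ a = max (c $ a * X n \<omega> $ a) (innov (Suc n) \<omega> $ a)"
  using recursion[of "Suc n"] by (simp add: innov_def)

lemma X_nth_le_iff:
  assumes "\<omega> \<in> space M" "p \<le> j"
  shows "X j \<omega> $ a \<le> b \<longleftrightarrow> c $ a ^ (j - p) * X p \<omega> $ a \<le> b \<and>
    (\<forall>k\<in>{p<..j}. c $ a ^ (j - k) * innov k \<omega> $ a \<le> b)"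
  using c_bounds assms by (simp add: X_eq_path max_ar_path_le_iff[of c p j])

lemma X_le_iff:
  assumes "\<omega> \<in> space M" "p \<le> j"
  shows "X j \<omega> \<le> v \<longleftrightarrow> (\<forall>a. c $ a ^ (j - p) * X p \<omega> $ a \<le> v $ a) \<and>
    (\<forall>a. \<forall>k\<in>{p<..j}. c $ a ^ (j - k) * innov k \<omega> $ a \<le> v $ a)"
  using assms by (auto simp: less_eq_vec_def X_nth_le_iff[of \<omega> p j])

lemma prob_past_future:
  assumes "Measurable.pred (PiM {..p} (\<lambda>_. borel)) P" "Measurable.pred (PiM {p<..q} (\<lambda>_. borel)) Q"
  shows "\<P>(\<omega> in M. P (\<lambda>i\<in>{..p}. innov i \<omega>) \<and> Q (\<lambda>i\<in>{p<..q}. innov i \<omega>)) =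
    \<P>(\<omega> in M. P (\<lambda>i\<in>{..p}. innov i \<omega>)) * \<P>(\<omega> in M. Q (\<lambda>i\<in>{p<..q}. innov i \<omega>))"
proof -
  let ?A = "\<lambda>\<omega>. \<lambda>i\<in>{..p}. innov i \<omega>" and ?B = "\<lambda>\<omega>. \<lambda>i\<in>{p<..q}. innov i \<omega>"
  let ?P = "{z \<in> space (PiM {..p} (\<lambda>_. borel)). P z}"
  let ?Q = "{z \<in> space (PiM {p<..q} (\<lambda>_. borel)). Q z}"
  have "indep_var (PiM {..p} (\<lambda>_. borel)) ?A (PiM {p<..q} (\<lambda>_. borel)) ?B"
    by (rule indep_var_restrict[OF indep_innov]) auto
  then have "prob ((\<lambda>\<omega>. (?A \<omega>, ?B \<omega>)) -` (?P \<times> ?Q) \<inter> space M) =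
      prob (?A -` ?P \<inter> space M) * prob (?B -` ?Q \<inter> space M)"
    using assms by (intro indep_varD) auto
  moreover have "(\<lambda>\<omega>. (?A \<omega>, ?B \<omega>)) -` (?P \<times> ?Q) \<inter> space M = {\<omega> \<in> space M. P (?A \<omega>) \<and> Q (?B \<omega>)}"
    "?A -` ?P \<inter> space M = {\<omega> \<in> space M. P (?A \<omega>)}"
    "?B -` ?Q \<inter> space M = {\<omega> \<in> space M. Q (?B \<omega>)}"
    by (auto simp: space_PiM)
  ultimately show ?thesis by simp
qed

lemma margin_cdf_eq: "n \<ge> 1 \<Longrightarrow> margin_cdf F a t = \<P>(\<omega> in M. X n \<omega> $ a \<le> t)"
  using law[of n, symmetric]
  by (auto simp: margin_cdf_def cdf_def measure_distr distr_distr comp_def intro!: arg_cong[of _ _ prob])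

section \<open>Nonnegativity of the sequence\<close>

text \<open>A value of at most \<open>t\<close> forces a value of at most \<open>t / c $ a ^ m\<close> \<open>m\<close> steps earlier, for
  every \<open>m\<close>, and these bounds go to minus infinity.\<close>

lemma margin_cdf_negative:
  assumes "t < 0"
  shows "margin_cdf F a t = 0"
proof -
  have real_distr: "real_distribution (distr M borel (\<lambda>\<omega>. X 1 \<omega> $ a))"
    by simp
  have cdf: "margin_cdf F a = cdf (distr M borel (\<lambda>\<omega>. X 1 \<omega> $ a))"
    by (auto simp: margin_cdf_eq[of 1] cdf_def measure_distr fun_eq_iff intro!: arg_cong[of _ _ prob])
  have le: "margin_cdf F a t \<le> margin_cdf F a (t / c $ a ^ m)" for m
  proof -
    have "X 1 \<omega> $ a \<le> t / c $ a ^ m" if "\<omega> \<in> space M" "X (1 + m) \<omega> $ a \<le> t" for \<omega>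
    proof -
      have "c $ a ^ m * X 1 \<omega> $ a \<le> t"
        using that X_nth_le_iff[of \<omega> 1 "1 + m" a t] by simp
      then show ?thesis
        using c_bounds[of a] by (simp add: field_simps)
    qed
    then show ?thesis
      unfolding margin_cdf_eq[of "1 + m" a t, simplified] margin_cdf_eq[of 1 a "t / c $ a ^ m", simplified]
      by (intro finite_measure_mono) auto
  qed
  have "filterlim (\<lambda>m. t / c $ a ^ m) at_bot sequentially"
  proof -
    have "filterlim (\<lambda>m. inverse (c $ a ^ m)) at_top sequentially"
      using c_bounds[of a]
      by (intro filterlim_inverse_at_top LIMSEQ_realpow_zero always_eventually) auto
    then have "filterlim (\<lambda>m. t * inverse (c $ a ^ m)) at_bot sequentially"
      using assms by (subst filterlim_tendsto_neg_mult_at_bot_iff[OF tendsto_const]) auto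
    then show ?thesis by (simp add: field_simps)
  qed
  then have "(\<lambda>m. margin_cdf F a (t / c $ a ^ m)) \<longlonglongrightarrow> 0"
    unfolding cdf
    by (rule filterlim_compose[OF finite_borel_measure.cdf_lim_at_bot[OF
          real_distribution.finite_borel_measure_M[OF real_distr]]])
  then have "margin_cdf F a t \<le> 0"
    using le by (intro LIMSEQ_le_const) auto
  then show ?thesis
    by (auto simp: margin_cdf_eq[of 1] intro: antisym)
qed

lemma X_nonneg:
  assumes "n \<ge> 1"
  shows "AE \<omega> in M. \<forall>a. 0 \<le> X n \<omega> $ a"
proof -
  have "AE \<omega> in M. \<forall>m. \<not> X n \<omega> $ a \<le> - 1 / real (Suc m)" for a
  proof (subst AE_all_countable, rule allI)
    fix m
    have "prob {\<omega> \<in> space M. X n \<omega> $ a \<le> - 1 / real (Suc m)} = 0"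
      using margin_cdf_negative[of "- 1 / real (Suc m)" a] margin_cdf_eq[OF assms] by simp
    then show "AE \<omega> in M. \<not> X n \<omega> $ a \<le> - 1 / real (Suc m)"
      by (subst (asm) prob_Collect_eq_0) auto
  qed
  then have "AE \<omega> in M. \<forall>a m. \<not> X n \<omega> $ a \<le> - 1 / real (Suc m)"
    by (simp add: AE_all_countable)
  then show ?thesis
  proof eventually_elim
    case (elim \<omega>)
    show ?case
    proof (rule allI, rule ccontr)
      fix a assume "\<not> 0 \<le> X n \<omega> $ a"
      then obtain m where "inverse (real (Suc m)) < - X n \<omega> $ a"
        using reals_Archimedean[of "- X n \<omega> $ a"] by auto
      with elim[rule_format, of a m] show False
        by (simp add: field_simps)
    qed
  qed
qed

section \<open>Exceedances, mixing and upcrossings\<close>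

definition exceed :: "real^'d \<Rightarrow> real" where
  "exceed v = \<P>(\<omega> in M. \<not> X 1 \<omega> \<le> v)"

lemma prob_exceed:
  assumes "n \<ge> 1"
  shows "\<P>(\<omega> in M. \<not> X n \<omega> \<le> v) = exceed v"
proof -
  have m: "{x :: real^'d. \<not> x \<le> v} \<in> sets borel"
    by measurable
  have "\<P>(\<omega> in M. \<not> X k \<omega> \<le> v) = measure F {x. \<not> x \<le> v}" if "k \<ge> 1" for k
    using m by (subst law[OF that, symmetric], subst measure_distr)
      (auto intro!: arg_cong[of _ _ prob])
  with assms show ?thesis
    by (simp add: exceed_def)
qed

lemma exceed_le_sum: "exceed v \<le> (\<Sum>a\<in>UNIV. 1 - margin_cdf F a (v $ a))"
proof -
  have "{\<omega> \<in> space M. \<not> X 1 \<omega> \<le> v} = (\<Union>a. {\<omega> \<in> space M. \<not> X 1 \<omega> $ a \<le> v $ a})"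
    by (auto simp: less_eq_vec_def)
  then have "exceed v = prob (\<Union>a. {\<omega> \<in> space M. \<not> X 1 \<omega> $ a \<le> v $ a})"
    by (simp add: exceed_def)
  also have "\<dots> \<le> (\<Sum>a\<in>UNIV. prob {\<omega> \<in> space M. \<not> X 1 \<omega> $ a \<le> v $ a})"
    by (intro finite_measure_subadditive_finite) auto
  also have "\<dots> = (\<Sum>a\<in>UNIV. 1 - margin_cdf F a (v $ a))"
    by (simp add: margin_cdf_eq[of 1] prob_neg)
  finally show ?thesis .
qed

text \<open>By unfolding to \<open>p = Max I\<close>, the event \<open>\<forall>j\<in>J. X j \<le> v\<close> says that the discounted innovations
  after \<open>p\<close> are small and that the discounted \<open>X p\<close> is small. Without the second condition the
  event is independent of the past, and the condition fails only where \<open>X p\<close> itself exceeds \<open>v\<close>,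
  by nonnegativity.\<close>

lemma mixing_bound:
  assumes I: "I \<noteq> {}" "finite I" "I \<subseteq> {1..}" and J: "J \<noteq> {}" "finite J" "Max I < Min J"
  shows "\<bar>\<P>(\<omega> in M. (\<forall>i\<in>I. X i \<omega> \<le> v) \<and> (\<forall>j\<in>J. X j \<omega> \<le> v))
    - \<P>(\<omega> in M. \<forall>i\<in>I. X i \<omega> \<le> v) * \<P>(\<omega> in M. \<forall>j\<in>J. X j \<omega> \<le> v)\<bar> \<le> exceed v"
proof -
  define p q where "p = Max I" and "q = Max J"
  have Ip: "i \<le> p" if "i \<in> I" for i
    using that I by (simp add: p_def)
  have "p \<in> I"
    using I by (simp add: p_def)
  with I have "p \<ge> 1" by auto
  have Jp: "p < j \<and> j \<le> q" if "j \<in> J" for j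
    using that J by (auto simp: p_def q_def)
  \<comment> \<open>\<open>?B'\<close> is \<open>?B\<close> with the contribution of \<open>X p\<close> to the later values removed.\<close>
  let ?P = "\<lambda>z. \<forall>i\<in>I. max_ar_path c i z \<le> v"
  let ?Q = "\<lambda>z. \<forall>j\<in>J. \<forall>a. \<forall>k\<in>{p<..j}. c $ a ^ (j - k) * z k $ a \<le> v $ a"
  let ?A = "{\<omega> \<in> space M. \<forall>i\<in>I. X i \<omega> \<le> v}"
  let ?B = "{\<omega> \<in> space M. \<forall>j\<in>J. X j \<omega> \<le> v}"
  let ?B' = "{\<omega> \<in> space M. ?Q (\<lambda>k. innov k \<omega>)}"
  have pathI: "max_ar_path c i (\<lambda>k\<in>{..p}. innov k \<omega>) = X i \<omega>" if "\<omega> \<in> space M" "i \<in> I" for i \<omega>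
    using that Ip by (simp add: X_eq_path max_ar_path_restrict)
  have QJ: "?Q (\<lambda>k\<in>{p<..q}. innov k \<omega>) \<longleftrightarrow> ?Q (\<lambda>k. innov k \<omega>)" for \<omega>
  proof -
    have "k \<in> {p<..q}" if "k \<in> {p<..j}" "j \<in> J" for j k
      using Jp[OF that(2)] that(1) by auto
    then show ?thesis
      by (intro ball_cong iff_allI refl) (metis restrict_apply')
  qed
  have "Measurable.pred (PiM {..p} (\<lambda>_. borel)) ?P"
    using I(2) Ip by (intro pred_intros_finite pred_vec_le measurable_max_ar_path) auto
  moreover have "Measurable.pred (PiM {p<..q} (\<lambda>_. borel)) ?Q"
  proof (intro pred_intros_finite(3) pred_intros_countable(1) J(2))
    fix j a k assume "j \<in> J" "k \<in> {p<..j}"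
    then have [measurable]: "(\<lambda>z. z k) \<in> borel_measurable (PiM {p<..q} (\<lambda>_. borel :: (real^'d) measure))"
      using Jp[of j] by (intro measurable_component_singleton) auto
    show "Measurable.pred (PiM {p<..q} (\<lambda>_. borel)) (\<lambda>z. c $ a ^ (j - k) * z k $ a \<le> v $ a)"
      by measurable
  qed auto
  ultimately have "\<P>(\<omega> in M. ?P (\<lambda>i\<in>{..p}. innov i \<omega>) \<and> ?Q (\<lambda>i\<in>{p<..q}. innov i \<omega>)) =
      \<P>(\<omega> in M. ?P (\<lambda>i\<in>{..p}. innov i \<omega>)) * \<P>(\<omega> in M. ?Q (\<lambda>i\<in>{p<..q}. innov i \<omega>))"
    by (rule prob_past_future)
  moreover have "{\<omega> \<in> space M. ?P (\<lambda>i\<in>{..p}. innov i \<omega>) \<and> ?Q (\<lambda>i\<in>{p<..q}. innov i \<omega>)} = ?A \<inter> ?B'"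
    "{\<omega> \<in> space M. ?P (\<lambda>i\<in>{..p}. innov i \<omega>)} = ?A"
    unfolding QJ using pathI by auto
  ultimately have indep: "prob (?A \<inter> ?B') = prob ?A * prob ?B'"
    by (simp only: QJ)
  have [measurable]: "?A \<in> events" "?B \<in> events"
    using I(2) J(2) by measurable
  have [measurable]: "?B' \<in> events"
    using J(2) by measurable
  have BB': "?B \<subseteq> ?B'"
  proof safe
    fix \<omega> j a k assume "\<omega> \<in> space M" "\<forall>j\<in>J. X j \<omega> \<le> v" "j \<in> J" "k \<in> {p<..j}"
    then show "c $ a ^ (j - k) * innov k \<omega> $ a \<le> v $ a"
      using Jp[of j] X_le_iff[of \<omega> p j v] by auto
  qed
  have "prob (?B' - ?B) \<le> exceed v"
  proof -
    have "AE \<omega> in M. \<omega> \<in> ?B' - ?B \<longrightarrow> \<omega> \<in> {\<omega> \<in> space M. \<not> X p \<omega> \<le> v}"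
      using X_nonneg[OF \<open>p \<ge> 1\<close>]
    proof eventually_elim
      case (elim \<omega>)
      show ?case
      proof (rule impI, rule ccontr)
        assume *: "\<omega> \<in> ?B' - ?B" "\<omega> \<notin> {\<omega> \<in> space M. \<not> X p \<omega> \<le> v}"
        then have sp: "\<omega> \<in> space M" and Xp: "X p \<omega> \<le> v" by auto
        have "c $ a ^ m * X p \<omega> $ a \<le> v $ a" for a m
        proof -
          have "c $ a ^ m * X p \<omega> $ a \<le> 1 * X p \<omega> $ a"
            using c_bounds[of a] elim by (intro mult_right_mono power_le_one) (auto intro: less_imp_le)
          also have "\<dots> \<le> v $ a"
            using Xp by (simp add: less_eq_vec_def)
          finally show ?thesis .
        qed
        then have "X j \<omega> \<le> v" if "j \<in> J" for j
          using * that Jp[OF that] by (subst X_le_iff[OF sp, of p]) auto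
        with * show False by auto
      qed
    qed
    then have "prob (?B' - ?B) \<le> prob {\<omega> \<in> space M. \<not> X p \<omega> \<le> v}"
      by (intro finite_measure_mono_AE) auto
    with prob_exceed[OF \<open>p \<ge> 1\<close>] show ?thesis by simp
  qed
  moreover have "\<bar>prob (?A \<inter> ?B) - prob ?A * prob ?B\<bar> \<le> prob (?B' - ?B)"
    using BB' indep by (intro almost_indep_of_superset) auto
  moreover have "{\<omega> \<in> space M. (\<forall>i\<in>I. X i \<omega> \<le> v) \<and> (\<forall>j\<in>J. X j \<omega> \<le> v)} = ?A \<inter> ?B"
    by auto
  ultimately show ?thesis by simp
qed

text \<open>After \<open>X i \<le> v\<close>, the discounted old value stays below \<open>v\<close> by nonnegativity, so only a fresh
  innovation can exceed \<open>v\<close>, and it does so no more often than the path itself.\<close>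

lemma upcrossing_bound:
  assumes "i \<ge> 1"
  shows "\<P>(\<omega> in M. \<not> X 1 \<omega> \<le> v \<and> X i \<omega> \<le> v \<and> \<not> X (i + 1) \<omega> \<le> v) \<le> (exceed v)\<^sup>2"
proof -
  have "AE \<omega> in M. \<not> X 1 \<omega> \<le> v \<and> X i \<omega> \<le> v \<and> \<not> X (i + 1) \<omega> \<le> v \<longrightarrow>
      \<not> X 1 \<omega> \<le> v \<and> \<not> innov (i + 1) \<omega> \<le> v"
    using X_nonneg[OF assms] AE_space
  proof eventually_elim
    case (elim \<omega>)
    show ?case
    proof (intro impI conjI notI)
      assume *: "\<not> X 1 \<omega> \<le> v \<and> X i \<omega> \<le> v \<and> \<not> X (i + 1) \<omega> \<le> v" and inn: "innov (i + 1) \<omega> \<le> v"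
      have "c $ a * X i \<omega> $ a \<le> 1 * X i \<omega> $ a" for a
        using c_bounds[of a] elim by (intro mult_right_mono) (auto intro: less_imp_le)
      moreover have "X i \<omega> $ a \<le> v $ a" for a
        using * by (simp add: less_eq_vec_def)
      ultimately have "c $ a * X i \<omega> $ a \<le> v $ a" for a
        by (smt (verit))
      then have "X (i + 1) \<omega> \<le> v"
        using inn elim by (simp add: less_eq_vec_def X_Suc)
      with * show False by simp
    qed auto
  qed
  then have "\<P>(\<omega> in M. \<not> X 1 \<omega> \<le> v \<and> X i \<omega> \<le> v \<and> \<not> X (i + 1) \<omega> \<le> v) \<le>
      \<P>(\<omega> in M. \<not> X 1 \<omega> \<le> v \<and> \<not> innov (i + 1) \<omega> \<le> v)"
    by (intro finite_measure_mono_AE) auto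
  also have "\<dots> = exceed v * \<P>(\<omega> in M. \<not> innov (i + 1) \<omega> \<le> v)"
  proof -
    have "Measurable.pred (PiM {..i} (\<lambda>_. borel)) (\<lambda>z. \<not> max_ar_path c 1 z \<le> v)"
      using assms by (intro pred_intros_logic pred_vec_le measurable_max_ar_path)
    moreover have "Measurable.pred (PiM {i<..i+1} (\<lambda>_. borel)) (\<lambda>z. \<not> z (i + 1) \<le> v)"
      by (intro pred_intros_logic pred_vec_le measurable_component_singleton) auto
    ultimately have "\<P>(\<omega> in M. \<not> max_ar_path c 1 (\<lambda>k\<in>{..i}. innov k \<omega>) \<le> v \<and>
          \<not> (\<lambda>k\<in>{i<..i+1}. innov k \<omega>) (i + 1) \<le> v) =
        \<P>(\<omega> in M. \<not> max_ar_path c 1 (\<lambda>k\<in>{..i}. innov k \<omega>) \<le> v) *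
        \<P>(\<omega> in M. \<not> (\<lambda>k\<in>{i<..i+1}. innov k \<omega>) (i + 1) \<le> v)"
      by (rule prob_past_future)
    then show ?thesis
      using assms unfolding max_ar_path_restrict[OF assms]
      by (simp add: exceed_def X_eq_path cong: conj_cong)
  qed
  also have "\<dots> \<le> exceed v * exceed v"
  proof (intro mult_left_mono)
    have "\<P>(\<omega> in M. \<not> innov (i + 1) \<omega> \<le> v) \<le> \<P>(\<omega> in M. \<not> X (i + 1) \<omega> \<le> v)"
      by (intro finite_measure_mono) (auto simp: less_eq_vec_def X_Suc)
    then show "\<P>(\<omega> in M. \<not> innov (i + 1) \<omega> \<le> v) \<le> exceed v"
      by (simp only: prob_exceed le_add2)
  qed (simp add: exceed_def)
  finally show ?thesis by (simp add: power2_eq_square)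
qed

lemma exceed_bound:
  assumes "\<And>a. (\<lambda>n. real n * (1 - margin_cdf F a (u n $ a))) \<longlonglongrightarrow> \<tau> $ a"
  obtains K where "K \<ge> 0" "\<And>n. real n * exceed (u n) \<le> K"
proof -
  have "(\<lambda>n. \<Sum>a\<in>UNIV. real n * (1 - margin_cdf F a (u n $ a))) \<longlonglongrightarrow> (\<Sum>a\<in>UNIV. \<tau> $ a)"
    by (intro tendsto_sum assms)
  then have "Bseq (\<lambda>n. \<Sum>a\<in>UNIV. real n * (1 - margin_cdf F a (u n $ a)))"
    by (intro convergent_imp_Bseq convergentI)
  then obtain K where K: "\<And>n. norm (\<Sum>a\<in>UNIV. real n * (1 - margin_cdf F a (u n $ a))) \<le> K"
    unfolding Bseq_def by blast
  have "real n * exceed (u n) \<le> K" for n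
  proof -
    have "real n * exceed (u n) \<le> real n * (\<Sum>a\<in>UNIV. 1 - margin_cdf F a (u n $ a))"
      by (intro mult_left_mono exceed_le_sum) simp_all
    also have "\<dots> \<le> K"
      using K[of n] by (simp add: sum_distrib_left)
    finally show ?thesis .
  qed
  moreover have "K \<ge> 0"
    using K[of 0] by simp
  ultimately show ?thesis by (intro that)
qed

end

section \<open>Choice of the block lengths\<close>

lemma filterlim_floor_sqrt: "filterlim floor_sqrt at_top sequentially"
  unfolding filterlim_at_top eventually_sequentially
  by (metis le_floor_sqrtI)

lemma floor_sqrt_le_sqrt: "real (floor_sqrt n) \<le> sqrt (real n)"
  by (rule real_le_rsqrt) (metis floor_sqrt_power2_le of_nat_le_iff of_nat_power)

lemma Suc_floor_sqrt_div_tendsto: "(\<lambda>m. real (Suc (floor_sqrt m)) / real m) \<longlonglongrightarrow> 0"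
proof (rule tendsto_sandwich[of "\<lambda>_. 0"])
  show "(\<lambda>m. (sqrt (real m) + 1) / real m) \<longlonglongrightarrow> 0"
    by real_asymp
  show "\<forall>\<^sub>F m in sequentially. real (Suc (floor_sqrt m)) / real m \<le> (sqrt (real m) + 1) / real m"
    using floor_sqrt_le_sqrt by (intro always_eventually allI divide_right_mono) (auto simp: add.commute)
qed auto

text \<open>The sum in the condition has at most \<open>n / k n\<close> terms, each at most \<open>(K / n)\<^sup>2\<close>.\<close>

lemma (in stationary_max_ar) cond_D''_of_bounded_exceedances:
  assumes K: "K \<ge> 0" "\<And>n. real n * exceed (u n) \<le> K"
  shows "cond_D'' M X u"
proof -
  \<comment> \<open>With \<open>l n * l n \<le> n\<close>, each growth condition on \<open>l\<close>, \<open>\<alpha>\<close> and \<open>k\<close> follows from \<open>l n\<close> tending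
    to infinity or \<open>k n / l n\<close> tending to \<open>0\<close>; the successor keeps \<open>k 0\<close> positive.\<close>
  define l where "l = floor_sqrt"
  define \<alpha> where "\<alpha> = (\<lambda>m. K / real m)"
  define k where "k = (\<lambda>n. Suc (floor_sqrt (l n)))"
  have l: "filterlim l at_top sequentially"
    unfolding l_def by (rule filterlim_floor_sqrt)
  have k: "filterlim k at_top sequentially"
    unfolding k_def by (intro filterlim_compose[OF filterlim_Suc] filterlim_compose[OF filterlim_floor_sqrt] l)
  have K_div: "exceed (u n) \<le> K / real n" if "n > 0" for n
    using K(2)[of n] that by (simp add: field_simps)
  have l_div: "real (l n) / real n \<le> 1 / real (l n)" if "n > 0" for n
  proof -
    have "real (l n) * real (l n) \<le> real n"
      using floor_sqrt_power2_le[of n] unfolding l_def power2_eq_square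
      by (metis of_nat_le_iff of_nat_mult)
    moreover have "l n > 0" using that by (simp add: l_def)
    ultimately show ?thesis using that by (simp add: field_simps)
  qed
  have k_div_l: "(\<lambda>n. real (k n) / real (l n)) \<longlonglongrightarrow> 0"
    unfolding k_def by (rule filterlim_compose[OF Suc_floor_sqrt_div_tendsto l])
  have inv_l: "(\<lambda>n. 1 / real (l n)) \<longlonglongrightarrow> 0"
    by (rule filterlim_compose[OF lim_1_over_n l])
  have "cond_D M X u l \<alpha>"
    unfolding cond_D_def
  proof (intro conjI allI impI)
    show "(\<lambda>n. real (l n) / real n) \<longlonglongrightarrow> 0"
      by (rule tendsto_sandwich[OF _ _ tendsto_const inv_l])
        (use l_div in \<open>auto intro!: eventually_mono[OF eventually_gt_at_top[of 0]]\<close>)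
    show "(\<lambda>n. \<alpha> (l n)) \<longlonglongrightarrow> 0"
      using tendsto_mult_right_zero[OF inv_l, of K] by (simp add: \<alpha>_def)
    fix n :: nat and I J :: "nat set"
    assume IJ: "I \<noteq> {}" "J \<noteq> {}" "I \<subseteq> {1..n}" "J \<subseteq> {1..n}" "Max I < Min J"
    then have "n > 0" by auto
    have "\<bar>measure M {\<omega> \<in> space M. (\<forall>i\<in>I. X i \<omega> \<le> u n) \<and> (\<forall>j\<in>J. X j \<omega> \<le> u n)}
          - measure M {\<omega> \<in> space M. \<forall>i\<in>I. X i \<omega> \<le> u n}
            * measure M {\<omega> \<in> space M. \<forall>j\<in>J. X j \<omega> \<le> u n}\<bar> \<le> exceed (u n)"
      using IJ by (intro mixing_bound) (auto intro: finite_subset)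
    also have "\<dots> \<le> K / real n"
      by (rule K_div) fact
    also have "\<dots> \<le> \<alpha> (l n)"
      using K(1) \<open>n > 0\<close> floor_sqrt_le[of n] unfolding \<alpha>_def l_def
      by (intro divide_left_mono) auto
    finally show "\<bar>measure M {\<omega> \<in> space M. (\<forall>i\<in>I. X i \<omega> \<le> u n) \<and> (\<forall>j\<in>J. X j \<omega> \<le> u n)}
          - measure M {\<omega> \<in> space M. \<forall>i\<in>I. X i \<omega> \<le> u n}
            * measure M {\<omega> \<in> space M. \<forall>j\<in>J. X j \<omega> \<le> u n}\<bar> \<le> \<alpha> (l n)" .
  qed (rule l)
  moreover have "(\<lambda>n. real (k n) * real (l n) / real n) \<longlonglongrightarrow> 0"
  proof (rule tendsto_sandwich[OF _ _ tendsto_const k_div_l])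
    show "\<forall>\<^sub>F n in sequentially. real (k n) * real (l n) / real n \<le> real (k n) / real (l n)"
      using eventually_gt_at_top[of 0]
    proof eventually_elim
      case (elim n)
      then show ?case
        using mult_left_mono[OF l_div[of n], of "real (k n)"] by simp
    qed
  qed auto
  moreover have "(\<lambda>n. real (k n) * \<alpha> (l n)) \<longlonglongrightarrow> 0"
    using tendsto_mult_right_zero[OF k_div_l, of K] by (simp add: \<alpha>_def mult.commute)
  moreover have "(\<lambda>n. real n * (\<Sum>i = 2..n div k n.
      measure M {\<omega> \<in> space M. \<not> X 1 \<omega> \<le> u n \<and> X i \<omega> \<le> u n \<and> \<not> X (i + 1) \<omega> \<le> u n}))
    \<longlonglongrightarrow> 0" (is "(\<lambda>n. real n * ?S n) \<longlonglongrightarrow> 0")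
  proof (rule tendsto_sandwich[OF _ _ tendsto_const])
    show "(\<lambda>n. K\<^sup>2 * (1 / real (k n))) \<longlonglongrightarrow> 0"
      by (intro tendsto_mult_right_zero filterlim_compose[OF lim_1_over_n k])
    show "\<forall>\<^sub>F n in sequentially. real n * ?S n \<le> K\<^sup>2 * (1 / real (k n))"
    proof (intro always_eventually allI)
      fix n
      have "?S n \<le> real (card {2..n div k n}) * (exceed (u n))\<^sup>2"
        by (intro sum_bounded_above upcrossing_bound) auto
      also have "\<dots> \<le> real n / real (k n) * (exceed (u n))\<^sup>2"
      proof (intro mult_right_mono)
        have "real (card {2..n div k n}) \<le> real (n div k n)" by simp
        also have "\<dots> \<le> real n / real (k n)" by (rule of_nat_div_le_of_nat)
        finally show "real (card {2..n div k n}) \<le> real n / real (k n)" .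
      qed simp
      finally have "real n * ?S n \<le> real n * (real n / real (k n) * (exceed (u n))\<^sup>2)"
        by (intro mult_left_mono) simp_all
      also have "\<dots> = (real n * exceed (u n))\<^sup>2 * (1 / real (k n))"
        by (simp add: power2_eq_square)
      also have "\<dots> \<le> K\<^sup>2 * (1 / real (k n))"
        by (intro mult_right_mono power_mono K) (auto simp: exceed_def)
      finally show "real n * ?S n \<le> K\<^sup>2 * (1 / real (k n))" .
    qed
  qed (auto intro!: always_eventually mult_nonneg_nonneg sum_nonneg)
  moreover have "k n > 0" for n
    by (simp add: k_def)
  ultimately show ?thesis
    unfolding cond_D''_def using k by blast
qed

theorem proposition3p2:
  fixes M :: "'a measure"
    and X Y :: "nat \<Rightarrow> 'a \<Rightarrow> real^'d"
    and F G :: "(real^'d) measure"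
    and H :: "'d \<Rightarrow> real \<Rightarrow> real"
    and c \<tau> :: "real^'d"
    and u :: "nat \<Rightarrow> real^'d"
  assumes "prob_space M"
    and "\<And>j. 0 < c $ j \<and> c $ j < 1"
    and "prob_space.indep_vars M (\<lambda>_. borel) (\<lambda>n. if n = 0 then X 0 else Y n) UNIV"
    and "\<And>n. n \<ge> 1 \<Longrightarrow> distr M borel (Y n) = G"
    and "\<And>n j \<omega>. n \<ge> 1 \<Longrightarrow> \<omega> \<in> space M \<Longrightarrow>
           X n \<omega> $ j = max (c $ j * X (n - 1) \<omega> $ j) (Y n \<omega> $ j)"
    and "stationary_seq M X"
    and "\<And>n. n \<ge> 1 \<Longrightarrow> distr M borel (X n) = F"
    and "nondegenerate_df (joint_cdf F)"
    and "\<And>j. extreme_value_df (H j)"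
    and "\<And>j. in_domain_of_attraction (margin_cdf F j) (H j)"
    and "\<And>j. \<tau> $ j \<ge> 0"
    and "\<And>j. (\<lambda>n. real n * (1 - margin_cdf F j (u n $ j))) \<longlonglongrightarrow> \<tau> $ j"
  shows "cond_D'' M X u"
proof -
  interpret stationary_max_ar M X Y F c
    using assms(1-3,5,7) by (simp add: stationary_max_ar_def stationary_max_ar_axioms_def)
  obtain K where "K \<ge> 0" "\<And>n. real n * exceed (u n) \<le> K"
    using exceed_bound assms(12) by blast
  then show ?thesis
    by (rule cond_D''_of_bounded_exceedances)
qed

end
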